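(* Let $n=p^m$ where $p$ is a prime and $m\ge1$ is an integer. Let $$S(B_n)=\left\langle\left\{\frac1p\binom n1,\dots,\frac1p\binom n{n-1}\right\}\right\rangle.$$ Then $$S(B_n)=\left\langle\left\{\frac1p\binom n1,\frac1p\binom n p,\frac1p\binom n{p^2},\dots,\frac1p\binom n{p^{m-1}}\right\}\right\rangle,$$ and the embedding dimension of $S(B_n)$ is $e(S(B_n))=m$.
   Context: $\mathbb{N}$ is the set of nonnegative integers. For nonempty $A\subseteq\mathbb{N}$, $\langle A\rangle$ denotes the submonoid of $(\mathbb{N},+)$ generated by $A$. A numerical semigroup is a submonoid of $\mathbb{N}$ with finite complement; $S(B_n)$ is a numerical semigroup. Every numerical semigroup $S$ has a unique minimal system of generators (a generating set no proper subset of which generates $S$), which is finite; its cardinality is the embedding dimension $e(S)$. *)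

theory Defs
  imports Complex_Main "HOL-Computational_Algebra.Primes"
begin

definition nat_submonoid :: "nat set \<Rightarrow> bool" where
  "nat_submonoid S \<longleftrightarrow> 0 \<in> S \<and> (\<forall>x\<in>S. \<forall>y\<in>S. x + y \<in> S)"

definition generated_submonoid :: "nat set \<Rightarrow> nat set" where
  "generated_submonoid A = nat_submonoid hull A"

definition minimal_generators :: "nat set \<Rightarrow> nat set \<Rightarrow> bool" where
  "minimal_generators A S \<longleftrightarrow>
     generated_submonoid A = S \<and> (\<forall>B. B \<subset> A \<longrightarrow> generated_submonoid B \<noteq> S)"

text \<open>The description is proper for every submonoid of the natural numbers, in particular
  for every numerical semigroup: see \<open>minimal_generators_unique\<close> below.\<close>

definition embedding_dimension :: "nat set \<Rightarrow> nat" where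
  "embedding_dimension S = card (THE A. minimal_generators A S)"

text \<open>For \<open>n = p ^ m\<close> the division by \<open>p\<close> is exact: see \<open>prime_dvd_prime_power_choose\<close> below.\<close>

definition binomial_semigroup :: "nat \<Rightarrow> nat \<Rightarrow> nat set" where
  "binomial_semigroup p n = generated_submonoid ((\<lambda>k. (n choose k) div p) ` {1..n - 1})"

lemma prime_dvd_prime_power_choose:
  fixes p m k :: nat
  assumes "prime p" "0 < k" "k < p ^ m"
  shows "p dvd (p ^ m choose k)"
proof (rule ccontr)
  assume "\<not> p dvd (p ^ m choose k)"
  then have cop: "coprime (p ^ m) (p ^ m choose k)"
    using assms(1) by (simp add: prime_imp_coprime)
  obtain j where j: "k = Suc j" using assms(2) by (cases k) auto
  obtain q where q: "p ^ m = Suc q" using assms(3) by (cases "p ^ m") auto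
  have "k * (p ^ m choose k) = p ^ m * (q choose j)"
    unfolding j q by (rule Suc_times_binomial)
  then have "p ^ m dvd k * (p ^ m choose k)" by simp
  then have "p ^ m dvd k" using cop by (simp add: coprime_dvd_mult_left_iff)
  then show False using assms(2,3) by (auto dest: dvd_imp_le)
qed

lemma nat_submonoid_generated: "nat_submonoid (generated_submonoid A)"
  unfolding generated_submonoid_def by (rule hull_in) (auto simp: nat_submonoid_def)

lemma generated_submonoid_superset: "A \<subseteq> generated_submonoid A"
  unfolding generated_submonoid_def by (rule hull_subset)

lemma generated_submonoid_least:
  "A \<subseteq> S \<Longrightarrow> nat_submonoid S \<Longrightarrow> generated_submonoid A \<subseteq> S"
  unfolding generated_submonoid_def by (rule hull_minimal)

lemma minimal_generators_unique:
  assumes S: "nat_submonoid S"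
  shows "\<exists>!A. minimal_generators A S"
proof -
  define I where "I = {x\<in>S. x \<noteq> 0 \<and> (\<forall>y\<in>S. \<forall>z\<in>S. x = y + z \<longrightarrow> y = 0 \<or> z = 0)}"
  have "x \<in> generated_submonoid I" if "x \<in> S" for x
    using that
  proof (induction x rule: less_induct)
    case (less x)
    consider "x = 0" | "x \<in> I"
      | y z where "y \<in> S" "z \<in> S" "x = y + z" "y \<noteq> 0" "z \<noteq> 0"
      using less.prems unfolding I_def by blast
    then show ?case
    proof cases
      case 1
      then show ?thesis using nat_submonoid_generated by (auto simp: nat_submonoid_def)
    next
      case 2
      then show ?thesis using generated_submonoid_superset by blast
    next
      case 3
      then have "y \<in> generated_submonoid I" "z \<in> generated_submonoid I"
        using less.IH by auto
      then show ?thesis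
        using 3 nat_submonoid_generated by (auto simp: nat_submonoid_def)
    qed
  qed
  moreover have "generated_submonoid I \<subseteq> S"
    by (rule generated_submonoid_least) (auto simp: I_def S)
  ultimately have gen: "generated_submonoid I = S" by blast
  have sub: "I \<subseteq> A" if A: "generated_submonoid A = S" for A
  proof (rule subsetI, rule ccontr)
    fix x assume x: "x \<in> I" "x \<notin> A"
    have "u + v \<noteq> x" if "u \<in> S - {x}" "v \<in> S - {x}" for u v
    proof
      assume "u + v = x"
      moreover have "\<forall>y\<in>S. \<forall>z\<in>S. x = y + z \<longrightarrow> y = 0 \<or> z = 0"
        using x(1) by (simp add: I_def)
      ultimately have "u = 0 \<or> v = 0" using that by (metis DiffD1)
      with \<open>u + v = x\<close> have "u = x \<or> v = x" by linarith
      with that show False by simp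
    qed
    moreover have "x \<noteq> 0" using x(1) by (simp add: I_def)
    ultimately have "nat_submonoid (S - {x})"
      using S unfolding nat_submonoid_def by blast
    moreover have "A \<subseteq> S - {x}" using generated_submonoid_superset A x(2) by blast
    ultimately have "S \<subseteq> S - {x}" using generated_submonoid_least A by blast
    then show False using x(1) by (auto simp: I_def)
  qed
  show ?thesis
  proof (rule ex1I[of _ I])
    have "generated_submonoid B \<noteq> S" if "B \<subset> I" for B
      using sub[of B] that by blast
    with gen show "minimal_generators I S" unfolding minimal_generators_def by blast
  next
    fix A assume "minimal_generators A S"
    then have A: "generated_submonoid A = S" and min: "\<not> I \<subset> A"
      using gen unfolding minimal_generators_def by blast+
    show "A = I" using sub[OF A] min by blast
  qed
qed

end

theory Submission
  imports Defs "HOL-Number_Theory.Cong"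
begin

text \<open>
  Write \<open>a i = (n choose p ^ i) div p\<close>. Then \<open>a i = p ^ (m - 1 - i) * u i\<close> with \<open>u i\<close> prime to \<open>p\<close>
  and \<open>a 0 = p ^ (m - 1)\<close>, so subtracting suitable multiples \<open>c * a j\<close> with \<open>c < p\<close>, for
  \<open>j = i, \<dots>, 1\<close>, brings any sufficiently large multiple of \<open>p ^ (m - 1 - i)\<close> to a multiple of \<open>a 0\<close>.
  If \<open>p ^ i\<close> exactly divides \<open>k\<close>, then \<open>(n choose k) div p\<close> is such a multiple, and it is large
  enough because the binomial coefficients grow quickly away from the boundary. No generator is
  redundant because \<open>a\<close> is increasing while its \<open>p\<close>-adic valuation is decreasing.
\<close>

section \<open>Closure rules for generated submonoids, and evaluation of the embedding
  dimension\<close>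

lemma generator_in_generated_submonoid: "x \<in> A \<Longrightarrow> x \<in> generated_submonoid A"
  using generated_submonoid_superset by blast

lemma zero_in_generated_submonoid: "0 \<in> generated_submonoid A"
  using nat_submonoid_generated[of A] by (simp add: nat_submonoid_def)

lemma add_in_generated_submonoid:
  "x \<in> generated_submonoid A \<Longrightarrow> y \<in> generated_submonoid A \<Longrightarrow> x + y \<in> generated_submonoid A"
  using nat_submonoid_generated[of A] by (simp add: nat_submonoid_def)

lemma mult_in_generated_submonoid:
  "x \<in> generated_submonoid A \<Longrightarrow> c * x \<in> generated_submonoid A"
  by (induction c) (simp_all add: zero_in_generated_submonoid add_in_generated_submonoid)

lemma generated_submonoid_mono: "A \<subseteq> B \<Longrightarrow> generated_submonoid A \<subseteq> generated_submonoid B"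
  by (meson generated_submonoid_least generated_submonoid_superset nat_submonoid_generated
      order_trans)

lemma embedding_dimension_eqI:
  assumes "minimal_generators A S"
  shows "embedding_dimension S = card A"
proof -
  have "nat_submonoid S"
    using assms nat_submonoid_generated by (auto simp: minimal_generators_def)
  then have "(THE A. minimal_generators A S) = A"
    by (rule the1_equality[OF minimal_generators_unique assms])
  then show ?thesis by (simp add: embedding_dimension_def)
qed

section \<open>Sequences with decreasing \<open>p\<close>-adic valuation: membership and
  minimality\<close>

text \<open>Descent on \<open>i\<close>: since \<open>u i\<close> is invertible mod
  \<open>p\<close>, removing at most \<open>p - 1\<close> copies of \<open>a i\<close> gains one
  more factor \<open>p\<close>, until a multiple of \<open>a 0 = p ^ d\<close> is left. The lower
  bound on \<open>x\<close> pays for \<open>p - 1\<close> copies of each of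
  \<open>a 1, ..., a i\<close>.\<close>

lemma large_multiple_in_generated_submonoid:
  fixes p d i x :: nat and a u :: "nat \<Rightarrow> nat"
  assumes p: "prime p"
    and a: "\<And>j. j \<le> d \<Longrightarrow> a j = p ^ (d - j) * u j"
    and u: "\<And>j. j \<le> d \<Longrightarrow> coprime (u j) p" and u0: "u 0 = 1"
    and "i \<le> d" "p ^ (d - i) dvd x" "(p - 1) * (\<Sum>j=1..i. a j) \<le> x"
  shows "x \<in> generated_submonoid (a ` {0..i})"
  using assms(5-)
proof (induction i arbitrary: x)
  case 0
  then obtain c where "x = a 0 * c" using a[of 0] u0 by auto
  moreover have "a 0 \<in> generated_submonoid (a ` {0..0})"
    by (intro generator_in_generated_submonoid) auto
  ultimately show ?case by (simp add: mult_in_generated_submonoid mult.commute)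
next
  case (Suc i)
  let ?q = "p ^ (d - Suc i)"
  obtain y where y: "x = ?q * y" using Suc.prems(2) by blast
  obtain v where v: "[u (Suc i) * v = 1] (mod p)"
    using cong_solve_coprime_nat u[OF Suc.prems(1)] by auto
  \<comment> \<open>Solves \<open>u (Suc i) * c = y\<close> mod \<open>p\<close>; the reduction mod
    \<open>p\<close> keeps \<open>c\<close> within the \<open>p - 1\<close> copies that the size
    bound allows.\<close>
  define c where "c = v * y mod p"
  have "c < p" using p prime_gt_0_nat by (simp add: c_def)
  have "[u (Suc i) * c = u (Suc i) * v * y] (mod p)"
    unfolding c_def cong_def by (simp add: mod_mult_right_eq mult.assoc)
  also have "[u (Suc i) * v * y = 1 * y] (mod p)"
    using v by (rule cong_mult) simp
  finally have cong: "[u (Suc i) * c = y] (mod p)" by simp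
  have ca: "c * a (Suc i) \<le> (p - 1) * a (Suc i)"
    using \<open>c < p\<close> by (intro mult_right_mono) auto
  moreover have split: "(p - 1) * (\<Sum>j=1..Suc i. a j) =
      (p - 1) * (\<Sum>j=1..i. a j) + (p - 1) * a (Suc i)"
    by (simp add: distrib_left)
  ultimately have le: "c * a (Suc i) \<le> x" and
    large: "(p - 1) * (\<Sum>j=1..i. a j) \<le> x - c * a (Suc i)"
    using Suc.prems(3) by linarith+
  have ca_eq: "c * a (Suc i) = ?q * (u (Suc i) * c)" using a[OF Suc.prems(1)] by simp
  have "?q > 0" using p prime_gt_0_nat by simp
  then have "u (Suc i) * c \<le> y" using le unfolding ca_eq y by simp
  then have "p dvd y - u (Suc i) * c" using cong by (simp add: cong_altdef_nat cong_sym_eq)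
  then have "?q * p dvd x - c * a (Suc i)"
    unfolding ca_eq y by (simp flip: diff_mult_distrib2)
  moreover have "?q * p = p ^ (d - i)"
    using Suc.prems(1) by (simp add: Suc_diff_Suc flip: power_Suc2)
  ultimately have "x - c * a (Suc i) \<in> generated_submonoid (a ` {0..i})"
    using Suc.IH large Suc.prems(1) by simp
  then have "x - c * a (Suc i) \<in> generated_submonoid (a ` {0..Suc i})"
    using generated_submonoid_mono[OF image_mono, of "{0..i}" "{0..Suc i}" a] by auto
  moreover have "a (Suc i) \<in> generated_submonoid (a ` {0..Suc i})"
    by (intro generator_in_generated_submonoid) auto
  ultimately have "x - c * a (Suc i) + c * a (Suc i) \<in> generated_submonoid (a ` {0..Suc i})"
    by (intro add_in_generated_submonoid mult_in_generated_submonoid)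
  then show ?case using le by simp
qed

text \<open>Each \<open>a i\<close> is separated from the other generators by a submonoid that
  contains all of them but not \<open>a i\<close>.\<close>

lemma minimal_generators_decreasing_valuation:
  fixes p d :: nat and a u :: "nat \<Rightarrow> nat"
  assumes p: "prime p"
    and a: "\<And>j. j \<le> d \<Longrightarrow> a j = p ^ (d - j) * u j"
    and u: "\<And>j. j \<le> d \<Longrightarrow> coprime (u j) p"
    and mono: "strict_mono_on {0..d} a"
  shows "minimal_generators (a ` {0..d}) (generated_submonoid (a ` {0..d}))"
  unfolding minimal_generators_def
proof (intro conjI allI impI notI refl)
  fix B assume B: "B \<subset> a ` {0..d}"
    and eq: "generated_submonoid B = generated_submonoid (a ` {0..d})"
  obtain i where i: "i \<le> d" "a i \<notin> B" using B by (auto dest!: psubset_imp_ex_mem)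
  \<comment> \<open>Closed under addition, since a sum with one summand above \<open>a i\<close>
    stays above it. Divisibility admits \<open>a j\<close> for \<open>j < i\<close>, size admits it
    for \<open>i < j\<close>, and \<open>a i\<close> fails both tests.\<close>
  define T where "T = {x. p ^ Suc (d - i) dvd x \<or> a i < x}"
  have "nat_submonoid T" unfolding nat_submonoid_def T_def by (auto simp: dvd_add)
  moreover have "B \<subseteq> T"
  proof
    fix b assume "b \<in> B"
    then obtain j where j: "j \<le> d" "b = a j"
      using psubset_imp_subset[OF B] by auto
    then have "j \<noteq> i" using i \<open>b \<in> B\<close> by auto
    then consider "j < i" | "i < j" by linarith
    then show "b \<in> T"
    proof cases
      case 1
      then have "p ^ Suc (d - i) dvd p ^ (d - j)" using i by (intro le_imp_power_dvd) auto
      then show ?thesis using j a by (simp add: T_def)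
    next
      case 2
      then show ?thesis using mono i j by (auto simp: T_def strict_mono_on_def)
    qed
  qed
  ultimately have "generated_submonoid B \<subseteq> T" by (rule generated_submonoid_least[rotated])
  moreover have "a i \<in> generated_submonoid B"
    using eq i by (simp add: generator_in_generated_submonoid)
  ultimately have "p ^ Suc (d - i) dvd a i" by (auto simp: T_def)
  then have "p dvd u i" using a[OF i(1)] p by (simp add: power_Suc2 del: power_Suc)
  moreover have "\<not> p dvd u i"
    using u[OF i(1)] p by (metis coprime_common_divisor dvd_refl not_prime_unit)
  ultimately show False by contradiction
qed

section \<open>Divisibility of binomial coefficients by powers of \<open>p\<close>\<close>

text \<open>By Pascal's rule neighbouring entries of row \<open>p ^ m - 1\<close> add up to an inner
  entry of row \<open>p ^ m\<close>, a multiple of \<open>p\<close>. So non-divisibility spreads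
  from the first entry 1.\<close>

lemma prime_not_dvd_prime_power_minus_one_choose:
  fixes p m j :: nat
  assumes "prime p" "j < p ^ m"
  shows "\<not> p dvd (p ^ m - 1 choose j)"
  using assms(2)
proof (induction j)
  case 0
  then show ?case using assms(1) by (simp add: prime_nat_iff)
next
  case (Suc j)
  have "p ^ m = Suc (p ^ m - 1)" using Suc.prems by simp
  then have "p ^ m choose Suc j = (p ^ m - 1 choose j) + (p ^ m - 1 choose Suc j)"
    by (metis binomial_Suc_Suc)
  moreover have "p dvd (p ^ m choose Suc j)"
    using prime_dvd_prime_power_choose assms(1) Suc.prems by blast
  ultimately show ?case using Suc by (metis Suc_lessD dvd_add_left_iff)
qed

text \<open>Absorption \<open>k * (n choose k) = n * (n - 1 choose (k - 1))\<close> at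
  \<open>k = p ^ i\<close>. One factor \<open>p\<close> is split off so that \<open>div p\<close>
  simply cancels it.\<close>

lemma prime_power_choose_prime_power:
  fixes p m i :: nat
  assumes "prime p" "i < m"
  shows "(p ^ m choose p ^ i) = p * (p ^ (m - 1 - i) * (p ^ m - 1 choose (p ^ i - 1)))"
proof -
  have p: "0 < p" using assms(1) prime_gt_0_nat by blast
  have split: "p ^ m * z = p ^ i * (p * (p ^ (m - 1 - i) * z))" for z
    using assms(2) by (simp flip: power_add power_Suc mult.assoc)
  have "p ^ i * (p ^ m choose p ^ i) = p ^ m * (p ^ m - 1 choose (p ^ i - 1))"
    using times_binomial_minus1_eq p by simp
  also note split
  finally show ?thesis using p by simp
qed

lemma prime_power_dvd_prime_power_choose:
  fixes p m i k :: nat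
  assumes p: "prime p" and "\<not> p dvd q" "k = p ^ i * q" "i \<le> m"
  shows "p ^ (m - i) dvd (p ^ m choose k)"
proof -
  have pos: "0 < p" "0 < q" using p prime_gt_0_nat assms(2) by (auto intro: Nat.gr0I)
  have split: "p ^ m * z = p ^ i * (p ^ (m - i) * z)" for z
    using assms(4) by (simp flip: power_add mult.assoc)
  have "p ^ i * (q * (p ^ m choose k)) = p ^ m * (p ^ m - 1 choose (k - 1))"
    using times_binomial_minus1_eq[of k "p ^ m"] pos assms(3) by (simp add: mult.assoc)
  also note split
  finally have "q * (p ^ m choose k) = p ^ (m - i) * (p ^ m - 1 choose (k - 1))"
    using pos by simp
  then have "p ^ (m - i) dvd q * (p ^ m choose k)" by simp
  moreover have "coprime (p ^ (m - i)) q" using p assms(2) by (simp add: prime_imp_coprime)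
  ultimately show ?thesis by (simp add: coprime_dvd_mult_right_iff)
qed

section \<open>Growth of binomial coefficients in the lower half of a row\<close>

text \<open>Two steps from \<open>r\<close> to \<open>r + 2\<close> multiply the coefficient by
  \<open>(n - r) * (n - r - 1) / ((r + 1) * (r + 2))\<close>, which is at least \<open>p\<close>;
  beyond that, monotonicity up to \<open>n / 2\<close> suffices. One step would gain less than
  \<open>p\<close> when \<open>n = p * r\<close>.\<close>

lemma mult_choose_le_choose:
  fixes n p r k :: nat
  assumes "2 \<le> p" "p \<le> r" "4 * r \<le> n" "p * r \<le> n" "r + 2 \<le> k" "2 * k \<le> n"
  shows "p * (n choose r) \<le> n choose k"
proof -
  let ?M = "n - r"
  have bound: "p * ((r + 1) * (r + 2)) \<le> ?M * (?M - 1)"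
  proof -
    \<comment> \<open>For \<open>p\<close> equal to 2 or 3 the bound \<open>(p - 1) * r\<close> on
      \<open>n - r\<close> can be too weak, so \<open>3 * r\<close>, from
      \<open>4 * r \<le> n\<close>, replaces it.\<close>
    consider "p = 2" | "p = 3" | "4 \<le> p" using assms(1) by linarith
    then obtain L where L: "L \<le> ?M" "p * ((r + 1) * (r + 2)) \<le> L * (L - 1)"
    proof cases
      case 1
      then obtain s where "r = 2 + s" using assms(2) le_Suc_ex by blast
      then show ?thesis using that[of "3 * r"] 1 assms(3) by (simp add: algebra_simps)
    next
      case 2
      then obtain s where "r = 3 + s" using assms(2) le_Suc_ex by blast
      then show ?thesis using that[of "3 * r"] 2 assms(3) by (simp add: algebra_simps)
    next
      case 3
      then obtain s t where st: "p = 4 + s" "r = 4 + s + t" using assms(2) le_Suc_ex by metis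
      have "p * ((r + 1) * (r + 2)) \<le> ((p - 1) * r) * ((p - 1) * r - 1)"
        by (simp add: st algebra_simps)
      moreover have "(p - 1) * r \<le> ?M" using assms(4) by (simp add: diff_mult_distrib)
      ultimately show ?thesis using that by blast
    qed
    have "L * (L - 1) \<le> ?M * (?M - 1)" using L(1) by (intro mult_mono) auto
    with L(2) show ?thesis by linarith
  qed
  have s: "(j + 1) * (n choose (j + 1)) = (n - j) * (n choose j)" for j
    by (metis Suc_eq_plus1 binomial_absorb_comp binomial_absorption)
  have "(r + 1) * (r + 2) * (n choose (r + 2)) = (r + 1) * ((n - (r + 1)) * (n choose (r + 1)))"
    using s[of "r + 1"] by (simp only: mult.assoc add.assoc one_add_one)
  also have "\<dots> = (?M * (?M - 1)) * (n choose r)"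
    using arg_cong[OF s[of r], of "\<lambda>z. (?M - 1) * z"]
    by (simp only: mult_ac diff_diff_left)
  also have "\<dots> \<ge> (p * ((r + 1) * (r + 2))) * (n choose r)"
    using bound by (rule mult_right_mono) simp
  finally have "(r + 1) * (r + 2) * (p * (n choose r)) \<le> (r + 1) * (r + 2) * (n choose (r + 2))"
    by (simp only: mult_ac)
  then have "p * (n choose r) \<le> n choose (r + 2)"
    by (rule mult_left_le_imp_le) simp
  also have "\<dots> \<le> n choose k" using assms by (intro binomial_mono) auto
  finally show ?thesis .
qed

text \<open>Brings the size threshold for membership down to \<open>p * a i\<close>: the weighted
  sum of the earlier terms is at most one copy of the next term.\<close>

lemma sum_geometric_growth_le:
  fixes a :: "nat \<Rightarrow> nat"
  assumes "1 \<le> p" "\<And>j. 1 \<le> j \<Longrightarrow> j < i \<Longrightarrow> p * a j \<le> a (Suc j)"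
  shows "(p - 1) * (\<Sum>j=1..i. a j) \<le> p * a i"
  using assms(2)
proof (induction i)
  case (Suc i)
  have "(p - 1) * (\<Sum>j=1..i. a j) \<le> a (Suc i)"
  proof (cases "i = 0")
    case False
    have "(p - 1) * (\<Sum>j=1..i. a j) \<le> p * a i" using Suc by simp
    also have "\<dots> \<le> a (Suc i)" using Suc.prems False by simp
    finally show ?thesis .
  qed simp
  moreover have "p * a (Suc i) = (p - 1) * a (Suc i) + a (Suc i)"
    using assms(1) by (cases p) auto
  ultimately show ?case by (simp add: distrib_left)
qed simp

section \<open>Generators and embedding dimension of the binomial semigroup of a prime power\<close>

theorem theorem3p6:
  fixes p m n :: nat
  assumes "prime p" and "m \<ge> 1" and "n = p ^ m"
  shows "binomial_semigroup p n =
           generated_submonoid ((\<lambda>i. (n choose (p ^ i)) div p) ` {0..m - 1}) \<and>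
         embedding_dimension (binomial_semigroup p n) = m"
proof -
  define a where "a i = (n choose (p ^ i)) div p" for i
  define u where "u i = (n - 1 choose (p ^ i - 1))" for i
  define G where "G = generated_submonoid (a ` {0..m - 1})"
  have p: "2 \<le> p" using assms(1) prime_ge_2_nat by blast
  have a: "a i = p ^ (m - 1 - i) * u i" and pa: "p * a i = n choose (p ^ i)"
    if "i \<le> m - 1" for i
    using prime_power_choose_prime_power[of p i m] that assms p by (simp_all add: a_def u_def)
  have u: "coprime (u i) p" if "i \<le> m - 1" for i
  proof -
    have "p ^ i < p ^ m" using that assms(2) p by (intro power_strict_increasing) auto
    then have "p ^ i - 1 < p ^ m" by linarith
    then show ?thesis
      using prime_not_dvd_prime_power_minus_one_choose assms(1,3) prime_imp_coprime
      by (metis coprime_commute u_def)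
  qed
  have p_le: "p * p ^ i \<le> n" if "i \<le> m - 1" for i
    using that assms p by (simp flip: power_Suc)
  have double_le: "2 * p ^ i \<le> n" if "i \<le> m - 1" for i
    using p_le[OF that] p by (meson mult_le_mono1 order_trans)
  have mono: "strict_mono_on {0..m - 1} a"
  proof (rule strict_mono_onI)
    fix i j assume ij: "i \<in> {0..m - 1}" "j \<in> {0..m - 1}" "i < j"
    have "2 * p ^ j \<le> n" using double_le[of j] ij by simp
    then have "n choose p ^ i < n choose p ^ j"
      using ij p by (intro binomial_strict_mono power_strict_increasing) auto
    then show "a i < a j" using pa[of i] pa[of j] ij by (metis atLeastAtMost_iff mult_less_cancel1)
  qed
  \<comment> \<open>Used twice: with \<open>k\<close> a power of \<open>p\<close> to compare
    consecutive generators, and with general \<open>k\<close> to reach the threshold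
    \<open>p * a i\<close>. The bounds on \<open>k\<close> supply \<open>4 * p ^ i \<le> n\<close>,
    and \<open>1 \<le> i\<close> supplies \<open>p \<le> p ^ i\<close>.\<close>
  have growth: "p * a i \<le> (n choose k) div p"
    if i: "1 \<le> i" "i \<le> m - 1" and k: "2 * p ^ i \<le> k" "2 * k \<le> n" for i k
  proof -
    have "p ^ 1 \<le> p ^ i" using i p by (intro power_increasing) auto
    then have "p * (n choose p ^ i) \<le> n choose k"
      using p_le[of i] i k p by (intro mult_choose_le_choose) auto
    then show ?thesis using pa[OF i(2)] p by (simp add: less_eq_div_iff_mult_less_eq mult_ac)
  qed
  \<comment> \<open>The growth estimate lives in the lower half of the row; the upper half follows
    later by the symmetry \<open>k\<close> to \<open>n - k\<close>.\<close>
  have half: "(n choose k) div p \<in> G" if k: "0 < k" "2 * k \<le> n" for k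
  proof -
    obtain i q where iq: "\<not> p dvd q" "k = p ^ i * q"
      using multiplicity_decompose'[of k p] k(1) assms(1) by (metis not_gr0 not_prime_unit)
    have "0 < q" using iq(2) k(1) by (auto intro: Nat.gr0I)
    have "p ^ i \<le> k" using iq(2) \<open>0 < q\<close> by simp
    then have "p ^ i < p ^ m" using k assms(3) by linarith
    then have "i < m" using power_less_imp_less_exp[of p i m] p by simp
    then have i: "i \<le> m - 1" by simp
    have aG: "a j \<in> G" if "j \<le> m - 1" for j
      using that by (simp add: G_def generator_in_generated_submonoid)
    show ?thesis
    \<comment> \<open>For \<open>q = 1\<close> the element is the generator \<open>a i\<close>
      itself; otherwise \<open>q \<ge> 2\<close> gives the gap \<open>2 * p ^ i \<le> k\<close> that
      \<open>growth\<close> asks for.\<close>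
    proof (cases "q = 1")
      case True
      then show ?thesis using aG[OF i] iq(2) by (simp add: a_def)
    next
      case False
      then have k2: "2 * p ^ i \<le> k" using iq(2) \<open>0 < q\<close> by simp
      have "(p - 1) * (\<Sum>j=1..i. a j) \<le> (n choose k) div p"
      proof (cases "i = 0")
        case False
        have "p * a j \<le> a (Suc j)" if j: "1 \<le> j" "j < i" for j
        proof -
          have "2 * p ^ Suc j \<le> n" using double_le[of "Suc j"] i j by simp
          moreover have "2 * p ^ j \<le> p ^ Suc j" using p by simp
          ultimately show ?thesis using growth[of j "p ^ Suc j"] i j by (simp add: a_def)
        qed
        then have "(p - 1) * (\<Sum>j=1..i. a j) \<le> p * a i"
          using p by (intro sum_geometric_growth_le) auto
        also have "\<dots> \<le> (n choose k) div p" using growth k k2 i False by simp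
        finally show ?thesis .
      qed simp
      moreover have "p ^ (m - 1 - i) dvd (n choose k) div p"
      proof -
        \<comment> \<open>The exponent is \<open>m - i\<close>; one factor \<open>p\<close> is lost
          to the division by \<open>p\<close>.\<close>
        have "p ^ Suc (m - 1 - i) dvd (n choose k)"
          using prime_power_dvd_prime_power_choose[of p q k i m] iq assms \<open>i < m\<close>
          by (simp add: Suc_diff_Suc del: power_Suc)
        then obtain t where "n choose k = p * (p ^ (m - 1 - i) * t)"
          by (metis dvdE mult.assoc power_Suc)
        then show ?thesis using p by simp
      qed
      moreover have "u 0 = 1" by (simp add: u_def)
      ultimately have "(n choose k) div p \<in> generated_submonoid (a ` {0..i})"
        using large_multiple_in_generated_submonoid[of p "m - 1" a u i] assms(1) a u i by blast
      then show ?thesis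
        using generated_submonoid_mono[OF image_mono, of "{0..i}" "{0..m - 1}" a] i
        by (auto simp: G_def)
    qed
  qed
  have "(n choose k) div p \<in> G" if k: "k \<in> {1..n - 1}" for k
  proof (cases "2 * k \<le> n")
    case False
    then have "(n choose (n - k)) div p \<in> G" using half[of "n - k"] k by auto
    moreover have "k \<le> n" using k by auto
    ultimately show ?thesis using binomial_symmetric[of k n] by simp
  qed (use half k in auto)
  then have "binomial_semigroup p n \<subseteq> G"
    unfolding binomial_semigroup_def
    by (intro generated_submonoid_least) (auto simp: G_def nat_submonoid_generated)
  moreover have "p ^ i \<in> {1..n - 1}" if "i \<le> m - 1" for i
  proof -
    have "p ^ i < n" unfolding assms(3) using that assms(2) p by (intro power_strict_increasing) auto
    then show ?thesis using p by auto
  qed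
  then have "G \<subseteq> binomial_semigroup p n"
    unfolding binomial_semigroup_def G_def by (intro generated_submonoid_mono) (auto simp: a_def)
  ultimately have eq: "binomial_semigroup p n = G" by blast
  have "minimal_generators (a ` {0..m - 1}) G"
    unfolding G_def using assms(1) a u mono by (rule minimal_generators_decreasing_valuation)
  then have "embedding_dimension G = card (a ` {0..m - 1})" by (rule embedding_dimension_eqI)
  also have "\<dots> = m"
    using card_image[OF strict_mono_on_imp_inj_on[OF mono]] assms(2) by simp
  finally show ?thesis using eq by (simp add: G_def a_def)
qed

end
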